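(* For every integer $n \geq 1$, the local page number of the complete graph $K_n$ on $n$ vertices satisfies $$\operatorname{pn}_\ell(K_n) \leq \frac{1}{3}n + 4.$$
   Context: For a fixed total ordering $\prec$ of the vertices of a graph $G$, two independent edges (edges with no common endpoint) $vw$ and $xy$ with $v \prec w$ and $x \prec y$ cross if $v \prec x \prec w \prec y$ or $x \prec v \prec y \prec w$. A page (with respect to $\prec$) is a set of edges that are pairwise non-crossing. A book embedding of $G$ consists of a vertex ordering $\prec$ and a partition of $E(G)$ into pages; it is $k$-local if each vertex has incident edges in at most $k$ of the pages. The local page number $\operatorname{pn}_\ell(G)$ is the smallest $k$ such that $G$ has a $k$-local book embedding (the total number of pages is unrestricted). *)

theory Defs
  imports Complex_Main "HOL-Library.Disjoint_Sets" "HOL-Library.Ramsey"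
begin

text \<open>A graph is a pair of a vertex set and a set of edges, each edge being a
  two-element set of vertices.\<close>

type_synonym 'a ugraph = "'a set \<times> 'a set set"

definition finite_simple_graph :: "'a ugraph \<Rightarrow> bool" where
  "finite_simple_graph G \<longleftrightarrow> finite (fst G) \<and> snd G \<subseteq> [fst G]\<^bsup>2\<^esup>"

definition complete_graph :: "nat \<Rightarrow> nat ugraph" where
  "complete_graph n = ({..<n}, [{..<n}]\<^bsup>2\<^esup>)"

definition vertex_ordering :: "'a ugraph \<Rightarrow> 'a rel \<Rightarrow> bool" where
  "vertex_ordering G r \<longleftrightarrow> r \<subseteq> fst G \<times> fst G \<and> strict_linear_order_on (fst G) r"

definition crossing :: "'a rel \<Rightarrow> 'a set \<Rightarrow> 'a set \<Rightarrow> bool" where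
  "crossing r e f \<longleftrightarrow> e \<inter> f = {} \<and>
     (\<exists>v w x y. e = {v, w} \<and> f = {x, y} \<and> (v, w) \<in> r \<and> (x, y) \<in> r \<and>
        ((v, x) \<in> r \<and> (x, w) \<in> r \<and> (w, y) \<in> r \<or>
         (x, v) \<in> r \<and> (v, y) \<in> r \<and> (y, w) \<in> r))"

definition is_page :: "'a rel \<Rightarrow> 'a set set \<Rightarrow> bool" where
  "is_page r p \<longleftrightarrow> (\<forall>e\<in>p. \<forall>f\<in>p. \<not> crossing r e f)"

definition book_embedding :: "'a ugraph \<Rightarrow> 'a rel \<Rightarrow> 'a set set set \<Rightarrow> bool" where
  "book_embedding G r P \<longleftrightarrow>
     vertex_ordering G r \<and> partition_on (snd G) P \<and> (\<forall>p\<in>P. is_page r p)"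

definition pages_at :: "'a set set set \<Rightarrow> 'a \<Rightarrow> 'a set set set" where
  "pages_at P v = {p \<in> P. \<exists>e\<in>p. v \<in> e}"

definition k_local :: "nat \<Rightarrow> 'a ugraph \<Rightarrow> 'a set set set \<Rightarrow> bool" where
  "k_local k G P \<longleftrightarrow> (\<forall>v\<in>fst G. finite (pages_at P v) \<and> card (pages_at P v) \<le> k)"

text \<open>For finite simple graphs the minimum below is attained, see
  \<open>ex_local_book_embedding\<close>; for other graphs the value may be unspecified.\<close>

definition local_page_number :: "'a ugraph \<Rightarrow> nat" where
  "local_page_number G = (LEAST k. \<exists>r P. book_embedding G r P \<and> k_local k G P)"

lemma finite_simple_graph_complete: "finite_simple_graph (complete_graph n)"
  by (simp add: finite_simple_graph_def complete_graph_def)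

lemma ex_vertex_ordering:
  assumes "finite (fst G)"
  shows "\<exists>r. vertex_ordering G r"
proof -
  obtain r where r: "well_order_on (fst G) r"
    using well_order_on by blast
  then have lin: "linear_order_on (fst G) r"
    by (simp add: well_order_on_def)
  then have "r \<subseteq> fst G \<times> fst G"
    using r well_order_on_domain by fast
  with strict_linear_order_on_diff_Id[OF lin] have "vertex_ordering G (r - Id)"
    by (auto simp: vertex_ordering_def)
  then show ?thesis ..
qed

lemma ex_local_book_embedding:
  assumes G: "finite_simple_graph G"
  shows "\<exists>k r P. book_embedding G r P \<and> k_local k G P"
proof -
  from G have V: "finite (fst G)" and E: "finite (snd G)"
    by (auto simp: finite_simple_graph_def intro: finite_subset finite_imp_finite_nsets)
  obtain r where r: "vertex_ordering G r"
    using ex_vertex_ordering[OF V] by blast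
  define P where "P = (\<lambda>e. {e}) ` snd G"
  have "partition_on (snd G) P"
    by (auto simp: P_def partition_on_def disjoint_def)
  moreover have "\<not> crossing r e e" for e
    using r by (auto simp: crossing_def)
  ultimately have "book_embedding G r P"
    using r by (auto simp: book_embedding_def is_page_def P_def)
  moreover have "finite P"
    using E by (simp add: P_def)
  then have "k_local (card P) G P"
    by (auto simp: k_local_def pages_at_def intro: card_mono)
  ultimately show ?thesis by blast
qed

end

theory Submission
  imports Defs
begin

text \<open>Place the vertices of \<open>K\<^sub>N\<close> on a circle, for an odd number \<open>N\<close>. All edges of one cyclic length
  \<open>l\<close>, where \<open>1 \<le> l \<le> (N - 1) / 2\<close>, are the \<open>N\<close> rotations of one of them. A page that is rotated in
  all \<open>N\<close> ways therefore covers every edge whose length occurs in the page, and if the page has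
  \<open>m\<close> vertices, then these rotations meet every vertex \<open>m\<close> times. So it suffices to distribute
  the \<open>(N - 1) / 2\<close> lengths among crossing-free graphs with few vertices in total.

  The graphs used here are fans: a centre \<open>0\<close>, vertices \<open>a\<^sub>0 < \<dots> < a\<^sub>4\<close>, the five spokes from the
  centre and the four rim edges between consecutive \<open>a\<^sub>i\<close>. A fan has six vertices and nine edges.
  If all these edges have different lengths, six vertices pay for nine lengths, which is a
  locality of \<open>(6/9) \<cdot> (N/2) = N/3\<close>.

  It remains to split the lengths into fans, that is, to find \<open>k\<close> fans, about \<open>N/18\<close>, such that the
  spokes and the differences of consecutive spokes have all lengths exactly once. Roughly,
  the lengths up to \<open>4k\<close> become rim edges and those between \<open>4k\<close> and \<open>9k\<close> become spokes. Let the
  \<open>j\<close>-th fan have \<open>a\<^sub>0, \<dots>, a\<^sub>4\<close> close to \<open>4k + j\<close>, \<open>8k - j\<close>, \<open>8k + j\<close>, \<open>12k - j\<close>, \<open>12k + j\<close>. As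
  cyclic lengths modulo \<open>18k\<close> these run through the five intervals of length \<open>k\<close> between \<open>4k\<close> and
  \<open>9k\<close>. Because the sign of \<open>j\<close> alternates, the differences move in steps of two: two of them run
  from \<open>4k\<close> down to \<open>2k\<close> and two run from \<open>0\<close> up to \<open>2k\<close>, and with the right constants
  one of each pair is odd and the other even (\<open>fan_lengths_exhaust\<close>).

  For \<open>N = 18k + 3 + 2q\<close> this leaves \<open>q + 1\<close> lengths over. A star with \<open>q + 2\<close> vertices takes
  them, which gives locality \<open>6k + q + 2\<close>. With \<open>q \<le> 8\<close> the additive constant \<open>4\<close> pays for the star
  and for rounding \<open>n\<close> up to an odd \<open>N\<close>.\<close>

section \<open>Local page number from a cover by pages\<close>

text \<open>Subsets of pages are pages, so it is harmless if the pages overlap: each edge keeps one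
  of the pages that contain it. Counting indices instead of pages is also harmless, since equal
  pages are then counted more than once.\<close>

lemma local_page_number_le_cover:
  fixes G :: "'a ugraph" and p :: "'i \<Rightarrow> 'a set set"
  assumes ord: "vertex_ordering G r"
    and cover: "snd G \<subseteq> (\<Union>i\<in>I. p i)"
    and page: "\<And>i. i \<in> I \<Longrightarrow> is_page r (p i)"
    and fin: "\<And>v. v \<in> fst G \<Longrightarrow> finite {i\<in>I. v \<in> \<Union>(p i)}"
    and card: "\<And>v. v \<in> fst G \<Longrightarrow> card {i\<in>I. v \<in> \<Union>(p i)} \<le> k"
  shows "local_page_number G \<le> k"
proof -
  have "\<forall>e\<in>snd G. \<exists>i. i \<in> I \<and> e \<in> p i"
    using cover by blast
  then obtain f where f: "\<And>e. e \<in> snd G \<Longrightarrow> f e \<in> I \<and> e \<in> p (f e)"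
    by metis
  define c where "c i = {e \<in> snd G. f e = i}" for i
  define P where "P = c ` f ` snd G"
  have "partition_on (snd G) P"
    by (auto simp: P_def c_def partition_on_def disjoint_def)
  moreover have "is_page r q" if "q \<in> P" for q
  proof -
    from that obtain e where "e \<in> snd G" and q: "q = c (f e)"
      by (auto simp: P_def)
    then have "f e \<in> I"
      using f by blast
    then have "is_page r (p (f e))"
      by (rule page)
    moreover have "q \<subseteq> p (f e)"
      unfolding q c_def using f by force
    ultimately show ?thesis
      by (simp add: is_page_def subset_iff)
  qed
  ultimately have "book_embedding G r P"
    using ord by (simp add: book_embedding_def)
  moreover have "k_local k G P"
    unfolding k_local_def
  proof
    fix v assume v: "v \<in> fst G"
    let ?J = "{i\<in>I. v \<in> \<Union>(p i)}"
    have sub: "pages_at P v \<subseteq> c ` ?J"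
    proof
      fix q assume "q \<in> pages_at P v"
      then obtain i e where "q = c i" "e \<in> c i" "v \<in> e"
        by (auto simp: pages_at_def P_def)
      moreover from this have "i \<in> I" "e \<in> p i"
        using f by (auto simp: c_def)
      ultimately show "q \<in> c ` ?J"
        by blast
    qed
    then have "finite (pages_at P v)"
      using fin[OF v] by (meson finite_imageI finite_subset)
    moreover have "card (pages_at P v) \<le> card ?J"
      using sub fin[OF v] by (meson card_image_le card_mono finite_imageI le_trans)
    ultimately show "finite (pages_at P v) \<and> card (pages_at P v) \<le> k"
      using card[OF v] by linarith
  qed
  ultimately show ?thesis
    unfolding local_page_number_def by (intro Least_le) blast
qed

section \<open>Rotated fans\<close>

text \<open>The edges of a fan on \<open>V\<close> with centre \<open>0\<close>: spokes, and rim edges between neighbours in \<open>V\<close>.\<close>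

definition fan_edge :: "int set \<Rightarrow> int \<Rightarrow> int \<Rightarrow> bool" where
  "fan_edge V x y \<longleftrightarrow> x \<in> V \<and> y \<in> V \<and> x < y \<and> (x = 0 \<or> (\<forall>z\<in>V. \<not> (x < z \<and> z < y)))"

definition rotated_fan :: "nat \<Rightarrow> int \<Rightarrow> int set \<Rightarrow> int \<Rightarrow> nat set set" where
  "rotated_fan n N V t = {{u, w} | u w. u < n \<and> w < n \<and>
     fan_edge V ((int u - t) mod N) ((int w - t) mod N)}"

lemma rotated_fanI:
  assumes "u < n" "w < n" "fan_edge V ((int u - t) mod N) ((int w - t) mod N)"
  shows "{u, w} \<in> rotated_fan n N V t"
  using assms unfolding rotated_fan_def by blast

text \<open>An edge that has a vertex of the fan strictly between its ends is a spoke. In a crossing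
  this holds for both edges, but edges with a common end do not cross.\<close>

lemma fan_edges_not_interleaved:
  assumes "fan_edge V a b" "fan_edge V c d" "a < c" "c < b"
  shows "d \<le> b"
  using assms unfolding fan_edge_def by force

lemma rotation_eq:
  fixes v t N :: int
  assumes "0 \<le> v" "v < N" "0 \<le> t" "t < N"
  shows "(v - t) mod N = (if t \<le> v then v - t else v - t + N)"
proof (cases "t \<le> v")
  case True
  then show ?thesis using assms by simp
next
  case False
  then have "(v - t + N) mod N = v - t + N"
    using assms by (intro mod_pos_pos_trivial) auto
  then show ?thesis using False by simp
qed

text \<open>Whether two chords cross depends on the cyclic order only. According to where the rotation
  cuts the circle, one of the four rotated ends comes first.\<close>

lemma rotated_fan_not_interleaved:
  fixes N t :: int and u x w y :: nat
  assumes e: "{u, w} \<in> rotated_fan n N V t" and f: "{x, y} \<in> rotated_fan n N V t"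
    and less: "u < x" "x < w" "w < y" and n: "int n \<le> N" and t: "0 \<le> t" "t < N"
  shows False
proof -
  define \<phi> where "\<phi> v = (int v - t) mod N" for v
  have uw: "u < n" "w < n" "fan_edge V (\<phi> u) (\<phi> w) \<or> fan_edge V (\<phi> w) (\<phi> u)"
    using e by (auto simp: rotated_fan_def \<phi>_def doubleton_eq_iff)
  have xy: "x < n" "y < n" "fan_edge V (\<phi> x) (\<phi> y) \<or> fan_edge V (\<phi> y) (\<phi> x)"
    using f by (auto simp: rotated_fan_def \<phi>_def doubleton_eq_iff)
  have \<phi>: "\<phi> v = (if t \<le> int v then int v - t else int v - t + N)" if "v < n" for v
    unfolding \<phi>_def using that n t by (intro rotation_eq) auto
  note \<phi>s = \<phi>[OF uw(1)] \<phi>[OF uw(2)] \<phi>[OF xy(1)] \<phi>[OF xy(2)]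
  have le: "a < b" if "fan_edge V a b" for a b
    using that by (simp add: fan_edge_def)
  consider "\<phi> u < \<phi> x" "\<phi> x < \<phi> w" "\<phi> w < \<phi> y" | "\<phi> x < \<phi> w" "\<phi> w < \<phi> y" "\<phi> y < \<phi> u"
    | "\<phi> w < \<phi> y" "\<phi> y < \<phi> u" "\<phi> u < \<phi> x" | "\<phi> y < \<phi> u" "\<phi> u < \<phi> x" "\<phi> x < \<phi> w"
  proof -
    have "int u < int x" "int x < int w" "int w < int y" "int y < N"
      using less xy(2) n by auto
    then consider "t \<le> int u" | "int u < t" "t \<le> int x" | "int x < t" "t \<le> int w"
      | "int w < t" "t \<le> int y" | "int y < t"
      by linarith
    then show thesis
      by cases (rule that; use \<phi>s \<open>int u < int x\<close> \<open>int x < int w\<close> \<open>int w < int y\<close> \<open>int y < N\<close> t in simp; fail)+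
  qed
  then show False
  proof cases
    case 1
    then show ?thesis
      using uw(3) xy(3) le fan_edges_not_interleaved[of V "\<phi> u" "\<phi> w" "\<phi> x" "\<phi> y"]
      by (smt (verit))
  next
    case 2
    then show ?thesis
      using uw(3) xy(3) le fan_edges_not_interleaved[of V "\<phi> x" "\<phi> y" "\<phi> w" "\<phi> u"]
      by (smt (verit))
  next
    case 3
    then show ?thesis
      using uw(3) xy(3) le fan_edges_not_interleaved[of V "\<phi> w" "\<phi> u" "\<phi> y" "\<phi> x"]
      by (smt (verit))
  next
    case 4
    then show ?thesis
      using uw(3) xy(3) le fan_edges_not_interleaved[of V "\<phi> y" "\<phi> x" "\<phi> u" "\<phi> w"]
      by (smt (verit))
  qed
qed

lemma is_page_rotated_fan:
  assumes "int n \<le> N" "0 \<le> t" "t < N"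
  shows "is_page {(a, b). a < b \<and> b < n} (rotated_fan n N V t)"
  unfolding is_page_def crossing_def
  using rotated_fan_not_interleaved[OF _ _ _ _ _ assms] by auto

text \<open>All rotations of a fan together contain every edge whose cyclic length occurs in the fan.
  A fan edge of length \<open>N - d\<close> serves for length \<open>d\<close>, with the roles of the two ends exchanged.\<close>

lemma ex_rotated_fan:
  fixes N :: int
  assumes uw: "u < w" "w < n" and n: "int n \<le> N" and V: "V \<subseteq> {0..<N}"
    and xy: "fan_edge V x y" and d: "y - x = int w - int u \<or> y - x = N - (int w - int u)"
  shows "\<exists>t\<in>{0..<N}. {u, w} \<in> rotated_fan n N V t"
proof -
  have x: "0 \<le> x" "x < N" and y: "0 \<le> y" "y < N"
    using xy V by (auto simp: fan_edge_def)
  have rot: "(a - (a - x) mod N) mod N = x" "(b - (a - x) mod N) mod N = (b - a + x) mod N" for a b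
    using x mod_diff_right_eq[of a "a - x" N] mod_diff_right_eq[of b "a - x" N]
    by (simp_all add: algebra_simps)
  from d show ?thesis
  proof
    assume d: "y - x = int w - int u"
    define t where "t = (int u - x) mod N"
    have "(int u - t) mod N = x" "(int w - t) mod N = y"
      using rot[of "int u"] rot(2)[of "int w" "int u"] d y by (simp_all add: t_def)
    then have "{u, w} \<in> rotated_fan n N V t"
      using uw xy by (intro rotated_fanI) auto
    moreover have "t \<in> {0..<N}"
      using x by (simp add: t_def)
    ultimately show ?thesis ..
  next
    assume d: "y - x = N - (int w - int u)"
    define t where "t = (int w - x) mod N"
    have "int u - int w + x = y - N"
      using d by simp
    then have "(int w - t) mod N = x" "(int u - t) mod N = y"
      using rot(1)[of "int w"] rot(2)[of "int u" "int w"] y by (simp_all add: t_def)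
    then have "{w, u} \<in> rotated_fan n N V t"
      using uw xy by (intro rotated_fanI) auto
    then have "{u, w} \<in> rotated_fan n N V t"
      by (simp add: insert_commute)
    moreover have "t \<in> {0..<N}"
      using x by (simp add: t_def)
    ultimately show ?thesis ..
  qed
qed

text \<open>A vertex is in the role of a given element of \<open>V i\<close> for exactly one rotation of the \<open>i\<close>-th
  fan, hence the sum. Taking \<open>n \<le> N\<close> instead of \<open>n = N\<close> costs nothing and later allows \<open>n\<close> to be
  rounded up.\<close>

theorem local_page_number_complete_le_fans:
  fixes V :: "'i \<Rightarrow> int set" and N :: int
  assumes I: "finite I" and V: "\<And>i. i \<in> I \<Longrightarrow> V i \<subseteq> {0..<N}" and n: "int n \<le> N"
    and lengths: "\<And>d. 0 < d \<Longrightarrow> 2 * d \<le> N \<Longrightarrow>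
      \<exists>i\<in>I. \<exists>x y. fan_edge (V i) x y \<and> (y - x = d \<or> y - x = N - d)"
  shows "local_page_number (complete_graph n) \<le> (\<Sum>i\<in>I. card (V i))"
proof (rule local_page_number_le_cover)
  let ?r = "{(a, b). a < b \<and> b < n}"
  let ?p = "\<lambda>(i, t). rotated_fan n N (V i) t"
  show "vertex_ordering (complete_graph n) ?r"
    by (auto simp: vertex_ordering_def complete_graph_def strict_linear_order_on_def
        trans_def irrefl_def total_on_def)
  show "snd (complete_graph n) \<subseteq> (\<Union>z\<in>I \<times> {0..<N}. ?p z)"
  proof
    fix e assume "e \<in> snd (complete_graph n)"
    then obtain a b where "e = {a, b}" "a < n" "b < n" "a \<noteq> b"
      by (auto simp: complete_graph_def nsets_def card_2_iff)
    then obtain u w where e: "e = {u, w}" and uw: "u < w" "w < n"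
      by (metis insert_commute linorder_neqE_nat)
    define d where "d = int w - int u"
    have d: "0 < d" "d < N"
      using uw n by (auto simp: d_def)
    have "\<exists>i\<in>I. \<exists>x y. fan_edge (V i) x y \<and> (y - x = d \<or> y - x = N - d)"
    proof (cases "2 * d \<le> N")
      case True
      then show ?thesis using lengths d by blast
    next
      case False
      then show ?thesis using lengths[of "N - d"] d by auto
    qed
    then obtain i x y where "i \<in> I" "fan_edge (V i) x y" "y - x = d \<or> y - x = N - d"
      by blast
    then show "e \<in> (\<Union>z\<in>I \<times> {0..<N}. ?p z)"
      using ex_rotated_fan[OF uw n V[of i]] unfolding e d_def by fastforce
  qed
  show "is_page ?r (?p z)" if "z \<in> I \<times> {0..<N}" for z
    using that is_page_rotated_fan[OF n] by auto
  fix v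
  let ?S = "SIGMA i:I. V i"
  let ?J = "{z \<in> I \<times> {0..<N}. v \<in> \<Union>(?p z)}"
  have finV: "finite (V i)" if "i \<in> I" for i
    using V[OF that] finite_subset by blast
  then have fin: "finite ?S"
    using I by auto
  have J: "?J \<subseteq> (\<lambda>(i, x). (i, (int v - x) mod N)) ` ?S"
  proof
    fix z assume z: "z \<in> ?J"
    obtain i t where it: "z = (i, t)"
      by (cases z)
    with z have "i \<in> I" and t: "0 \<le> t" "t < N" and "v \<in> \<Union>(rotated_fan n N (V i) t)"
      by simp_all
    then have "(int v - t) mod N \<in> V i"
      by (auto simp: rotated_fan_def fan_edge_def)
    moreover have "(int v - (int v - t) mod N) mod N = t"
      using t by (simp add: mod_diff_right_eq)
    ultimately show "z \<in> (\<lambda>(i, x). (i, (int v - x) mod N)) ` ?S"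
      unfolding it using \<open>i \<in> I\<close> by (intro image_eqI[of _ _ "(i, (int v - t) mod N)"]) auto
  qed
  from fin J show "finite ?J"
    by (rule finite_surj)
  from fin J have "card ?J \<le> card ?S"
    by (rule surj_card_le)
  also have "\<dots> = (\<Sum>i\<in>I. card (V i))"
    using I finV by (simp add: card_SigmaI)
  finally show "card ?J \<le> (\<Sum>i\<in>I. card (V i))" .
qed

section \<open>The lengths of the complete graph\<close>

text \<open>For \<open>j < k\<close> these are the fans with nine lengths each, and for \<open>j = k\<close> the star that takes the
  lengths left over.\<close>

definition length_fan :: "int \<Rightarrow> int \<Rightarrow> int \<Rightarrow> int set" where
  "length_fan k q j =
     (if j < k then {0, 4*k + q + 1 + j, 8*k + q + 1 - j, 8*k + q + 2 + j,
        12*k + q + 1 - j, 12*k + q + 3 + j}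
      else {0} \<union> {4*k + 1..4*k + q} \<union> {6*k + q + 1})"

lemma length_fan_subset:
  assumes "0 \<le> k" "0 \<le> q" "0 \<le> j"
  shows "length_fan k q j \<subseteq> {0..<18*k + 3 + 2*q}"
  using assms by (auto simp: length_fan_def)

lemma card_length_fan:
  assumes "0 \<le> q"
  shows "card (length_fan k q j) \<le> (if j < k then 6 else nat (q + 2))"
proof (cases "j < k")
  case True
  then show ?thesis by (simp add: length_fan_def card_insert_if)
next
  case False
  have "card ({0} \<union> {4*k + 1..4*k + q} \<union> {6*k + q + 1}) \<le>
      card ({0::int}) + card {4*k + 1..4*k + q} + card {6*k + q + 1}"
    by (meson card_Un_le add_le_mono le_refl le_trans)
  then show ?thesis using False assms by (simp add: length_fan_def)
qed

lemma fan_edge_length_fan: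
  assumes "0 \<le> j" "j < k" "0 \<le> q"
  shows "fan_edge (length_fan k q j) 0 (4*k + q + 1 + j)"
    "fan_edge (length_fan k q j) 0 (8*k + q + 1 - j)"
    "fan_edge (length_fan k q j) 0 (8*k + q + 2 + j)"
    "fan_edge (length_fan k q j) 0 (12*k + q + 1 - j)"
    "fan_edge (length_fan k q j) 0 (12*k + q + 3 + j)"
    "fan_edge (length_fan k q j) (4*k + q + 1 + j) (8*k + q + 1 - j)"
    "fan_edge (length_fan k q j) (8*k + q + 1 - j) (8*k + q + 2 + j)"
    "fan_edge (length_fan k q j) (8*k + q + 2 + j) (12*k + q + 1 - j)"
    "fan_edge (length_fan k q j) (12*k + q + 1 - j) (12*k + q + 3 + j)"
  using assms by (auto simp: fan_edge_def length_fan_def)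

lemma fan_edge_leftover:
  assumes "0 \<le> k" "0 \<le> q" "l \<in> {4*k + 1..4*k + q} \<union> {6*k + q + 1}"
  shows "fan_edge (length_fan k q k) 0 l"
  using assms by (auto simp: fan_edge_def length_fan_def)

text \<open>The rim edges take the lengths up to \<open>4k\<close>, with one rim edge for each half of this range and
  each parity. The spokes and the star take the rest, each spoke an interval of \<open>k\<close> lengths. The
  spokes to \<open>a\<^sub>3\<close> and \<open>a\<^sub>4\<close> have to be measured the other way round the circle. The length \<open>6k + q + 1\<close>
  separates the intervals of these two spokes. Without this gap, the rim edges on both sides of
  \<open>a\<^sub>3\<close> would change parity and repeat lengths.\<close>

lemma fan_lengths_exhaust:
  fixes k q d :: int
  assumes k: "0 \<le> k" and q: "0 \<le> q" and d: "0 < d" "2 * d \<le> 18*k + 3 + 2*q"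
  shows "\<exists>j\<in>{0..k}. \<exists>x y. fan_edge (length_fan k q j) x y \<and>
    (y - x = d \<or> y - x = 18*k + 3 + 2*q - d)"
proof -
  have witness: ?thesis
    if "0 \<le> j" "j < k" "fan_edge (length_fan k q j) x y"
      "y - x = d \<or> y - x = 18*k + 3 + 2*q - d" for j x y
    using that by (intro bexI[of _ j]) auto
  consider (rim) "d \<le> 4*k"
    | (leftover) "d \<in> {4*k + 1..4*k + q} \<union> {6*k + q + 1}"
    | (a0) "4*k + q < d" "d \<le> 5*k + q" | (a4) "5*k + q < d" "d \<le> 6*k + q"
    | (a3) "6*k + q + 1 < d" "d \<le> 7*k + q + 1" | (a1) "7*k + q + 1 < d" "d \<le> 8*k + q + 1"
    | (a2) "8*k + q + 1 < d" "d \<le> 9*k + q + 1"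
    using d by force
  then show ?thesis
  proof cases
    case rim
    obtain i where i: "d = 2*i \<or> d = 2*i + 1"
      by (metis oddE evenE)
    consider "d = 2*i" "i \<le> k" | "d = 2*i + 1" "i < k" | "d = 2*i" "k < i" | "d = 2*i + 1" "k \<le> i"
      using i by linarith
    then show ?thesis
    proof cases
      case 1
      then show ?thesis
        using witness[OF _ _ fan_edge_length_fan(9)[of "i - 1"]] d q by simp
    next
      case 2
      then show ?thesis
        using witness[OF _ _ fan_edge_length_fan(7)[of i]] d q by simp
    next
      case 3
      then show ?thesis
        using witness[OF _ _ fan_edge_length_fan(6)[of "2*k - i"]] rim k q by simp
    next
      case 4
      then show ?thesis
        using witness[OF _ _ fan_edge_length_fan(8)[of "2*k - 1 - i"]] rim k q by simp
    qed
  next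
    case leftover
    then show ?thesis
      using fan_edge_leftover[OF k q leftover] k by (intro bexI[of _ k] exI[of _ 0] exI[of _ d]) auto
  next
    case a0
    then show ?thesis
      using witness[OF _ _ fan_edge_length_fan(1)[of "d - (4*k + q + 1)"]] q by simp
  next
    case a4
    then show ?thesis
      using witness[OF _ _ fan_edge_length_fan(5)[of "6*k + q - d"]] q by simp
  next
    case a3
    then show ?thesis
      using witness[OF _ _ fan_edge_length_fan(4)[of "d - (6*k + q + 2)"]] q by simp
  next
    case a1
    then show ?thesis
      using witness[OF _ _ fan_edge_length_fan(2)[of "8*k + q + 1 - d"]] q by simp
  next
    case a2
    then show ?thesis
      using witness[OF _ _ fan_edge_length_fan(3)[of "d - (8*k + q + 2)"]] q by simp
  qed
qed

lemma local_page_number_complete_le: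
  fixes n k q :: nat
  assumes "n \<le> 18*k + 3 + 2*q"
  shows "local_page_number (complete_graph n) \<le> 6*k + q + 2"
proof -
  let ?V = "length_fan (int k) (int q)"
  have "local_page_number (complete_graph n) \<le> (\<Sum>j\<in>{0..int k}. card (?V j))"
    using assms length_fan_subset fan_lengths_exhaust
    by (intro local_page_number_complete_le_fans[where N = "18 * int k + 3 + 2 * int q"]) auto
  also have "\<dots> \<le> (\<Sum>j\<in>{0..int k}. if j < int k then 6 else nat (int q + 2))"
    by (intro sum_mono card_length_fan) simp
  also have "{0..int k} = insert (int k) {0..<int k}"
    by auto
  also have "(\<Sum>j\<in>\<dots>. if j < int k then 6 else nat (int q + 2)) = 6*k + q + 2"
    by (simp add: nat_add_distrib)
  finally show ?thesis .
qed

text \<open>The choice of \<open>k\<close> and \<open>q\<close> makes \<open>18k + 3 + 2q\<close> equal to \<open>n\<close> or \<open>n + 1\<close> for \<open>n \<ge> 2\<close>; the truncated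
  subtraction gives \<open>k = q = 0\<close> for \<open>n = 1\<close>. The bound \<open>q \<le> 8\<close> is just enough for even \<open>n\<close>.\<close>

theorem lemma10:
  fixes n :: nat
  assumes "n \<ge> 1"
  shows "real (local_page_number (complete_graph n)) \<le> 1/3 * real n + 4"
proof -
  define k s where "k = (n - 2) div 18" and "s = (n - 2) mod 18"
  define q where "q = s div 2"
  have n: "n - 2 = 18*k + s" and "s < 18"
    by (simp_all add: k_def s_def)
  have s: "s = 2*q \<or> s = 2*q + 1"
    unfolding q_def by linarith
  then have "q \<le> 8"
    using \<open>s < 18\<close> by linarith
  have "n \<le> 18*k + 3 + 2*q"
    using n s by linarith
  then have "local_page_number (complete_graph n) \<le> 6*k + q + 2"
    by (rule local_page_number_complete_le)
  moreover have "18*k + 2*q \<le> n - 2"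
    using n s by linarith
  then have "18*k + 2*q + 2 \<le> n \<or> k = 0 \<and> q = 0"
    using assms by auto
  then have "3 * (6*k + q + 2) \<le> n + 12"
    using \<open>q \<le> 8\<close> by auto
  ultimately have "3 * local_page_number (complete_graph n) \<le> n + 12"
    by (meson le_trans mult_le_mono2)
  then show ?thesis by linarith
qed

end
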